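(* The division gradings, by abelian groups, on the central simple finite-dimensional real associative algebras, with (nonzero) homogeneous components of dimension $2$, are determined up to isomorphism by the signs of the squares of the homogeneous elements that do not commute with the neutral component. Precisely: let $\mathcal{D}$ be a central simple finite-dimensional real associative algebra with a division grading by an abelian group $G$ whose nonzero homogeneous components have dimension $2$, let $T$ be its support and let $K\subseteq T$ be the support of the centralizer $C_{\mathcal{D}}(\mathcal{D}_e)$ of the neutral component. Then there is a well-defined map $\nu:T\setminus K\to\{\pm1\}$ such that, for every $t\in T\setminus K$ and every nonzero $X\in\mathcal{D}_t$, $X^2$ is a positive real multiple of $\nu(t)1$. If $\mathcal{D}'$ is another such $G$-graded algebra, with the same support $T$, the same $K$ and the same map $\nu$, then $\mathcal{D}$ and $\mathcal{D}'$ are isomorphic as $G$-graded algebras.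
   Context: A grading on an algebra $\mathcal{D}$ by a group $G$ (neutral element $e$) is a vector space decomposition $\mathcal{D}=\bigoplus_{g\in G}\mathcal{D}_g$ with $\mathcal{D}_g\mathcal{D}_h\subseteq\mathcal{D}_{gh}$ for all $g,h$. The support is the set of $g$ with $\mathcal{D}_g\neq0$, and $\mathcal{D}_e$ is the neutral component. A grading on a unital associative algebra is a division grading if every nonzero homogeneous element is invertible. Two $G$-graded algebras $\mathcal{D},\mathcal{D}'$ are isomorphic if there is an algebra isomorphism $\psi$ with $\psi(\mathcal{D}_g)=\mathcal{D}'_g$ for all $g\in G$. The centralizer is $C_{\mathcal{D}}(\mathcal{D}_e)=\{X\in\mathcal{D}\mid XY=YX\ \forall Y\in\mathcal{D}_e\}$. It is a graded subalgebra. The central simple finite-dimensional real associative algebras are, up to isomorphism, $M_n(\mathbb{R})$ and $M_n(\mathbb{H})$. *)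

theory Defs
  imports Complex_Main "HOL-Library.FuncSet"
begin

text \<open>
  A real associative algebra is a type of class \<open>real_algebra\<close>, a (nonzero) unital one a type of
  class \<open>real_algebra_1\<close>. Groups are types of class \<open>group_add\<close>, written additively, so the neutral
  element \<open>e\<close> is \<open>0\<close>. A grading is the family of its homogeneous components.
\<close>

definition central_algebra :: "'a::real_algebra_1 itself \<Rightarrow> bool" where
  "central_algebra _ \<longleftrightarrow> {z::'a. \<forall>x. z * x = x * z} = range of_real"

definition two_sided_ideal :: "'a::real_algebra set \<Rightarrow> bool" where
  "two_sided_ideal I \<longleftrightarrow> subspace I \<and> (\<forall>x\<in>I. \<forall>a. a * x \<in> I \<and> x * a \<in> I)"

text \<open>The zero algebra is excluded by the axiom \<open>0 \<noteq> 1\<close> of \<open>real_algebra_1\<close>.\<close>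

definition simple_algebra :: "'a::real_algebra_1 itself \<Rightarrow> bool" where
  "simple_algebra _ \<longleftrightarrow> (\<forall>I::'a set. two_sided_ideal I \<longrightarrow> I = {0} \<or> I = UNIV)"

definition finite_dimensional_algebra :: "'a::real_algebra itself \<Rightarrow> bool" where
  "finite_dimensional_algebra _ \<longleftrightarrow> (\<exists>B::'a set. finite B \<and> span B = UNIV)"

definition grading :: "('g::group_add \<Rightarrow> 'a::real_algebra set) \<Rightarrow> bool" where
  "grading D \<longleftrightarrow>
     (\<forall>g. subspace (D g)) \<and>
     (\<forall>x. \<exists>!f. (\<forall>g. f g \<in> D g) \<and> finite {g. f g \<noteq> 0} \<and> x = (\<Sum>g | f g \<noteq> 0. f g)) \<and>
     (\<forall>g h. \<forall>x\<in>D g. \<forall>y\<in>D h. x * y \<in> D (g + h))"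

definition division_grading :: "('g::group_add \<Rightarrow> 'a::real_algebra_1 set) \<Rightarrow> bool" where
  "division_grading D \<longleftrightarrow>
     grading D \<and> (\<forall>g. \<forall>x\<in>D g. x \<noteq> 0 \<longrightarrow> (\<exists>y. x * y = 1 \<and> y * x = 1))"

definition grading_support :: "('g \<Rightarrow> 'a::zero set) \<Rightarrow> 'g set" where
  "grading_support D = {g. D g \<noteq> {0}}"

definition centralizer :: "'a::times set \<Rightarrow> 'a set" where
  "centralizer S = {x. \<forall>y\<in>S. x * y = y * x}"

text \<open>The component of degree \<open>g\<close> of the graded subalgebra \<open>centralizer (D 0)\<close> is its
  intersection with \<open>D g\<close>.\<close>

definition neutral_centralizer_support :: "('g::group_add \<Rightarrow> 'a::real_algebra set) \<Rightarrow> 'g set" where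
  "neutral_centralizer_support D = grading_support (\<lambda>g. centralizer (D 0) \<inter> D g)"

definition two_dim_division_graded_csa :: "('g::ab_group_add \<Rightarrow> 'a::real_algebra_1 set) \<Rightarrow> bool" where
  "two_dim_division_graded_csa D \<longleftrightarrow>
     central_algebra TYPE('a) \<and> simple_algebra TYPE('a) \<and> finite_dimensional_algebra TYPE('a) \<and>
     division_grading D \<and> (\<forall>t\<in>grading_support D. dim (D t) = 2)"

text \<open>The extensional function space makes a map defined on \<open>T - K\<close> only a unique object.\<close>

definition square_sign_map :: "('g::group_add \<Rightarrow> 'a::real_algebra_1 set) \<Rightarrow> ('g \<Rightarrow> real) \<Rightarrow> bool" where
  "square_sign_map D \<nu> \<longleftrightarrow>
     \<nu> \<in> (grading_support D - neutral_centralizer_support D) \<rightarrow>\<^sub>E {1, -1} \<and>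
     (\<forall>t \<in> grading_support D - neutral_centralizer_support D. \<forall>X\<in>D t. X \<noteq> 0 \<longrightarrow>
        (\<exists>c>0. X ^ 2 = c *\<^sub>R (\<nu> t *\<^sub>R 1)))"

text \<open>A multiplicative bijection between unital algebras preserves \<open>1\<close>.\<close>

definition graded_isomorphic ::
  "('g::group_add \<Rightarrow> 'a::real_algebra set) \<Rightarrow> ('g \<Rightarrow> 'b::real_algebra set) \<Rightarrow> bool" where
  "graded_isomorphic D D' \<longleftrightarrow>
     (\<exists>\<psi>. linear \<psi> \<and> bij \<psi> \<and> (\<forall>x y. \<psi> (x * y) = \<psi> x * \<psi> y) \<and> (\<forall>g. \<psi> ` D g = D' g))"

end

theory Submission
  imports Defs
begin

text \<open>
  The neutral component is a copy of \<open>\<complex>\<close>, and \<open>D t = \<complex> X\<close> for every nonzero \<open>X \<in> D t\<close>, where \<open>X\<close>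
  commutes with \<open>\<complex>\<close> if \<open>t \<in> K\<close> and induces complex conjugation otherwise. Conjugating by an element
  outside \<open>K\<close> shows that the commutators of homogeneous elements with degrees in \<open>K\<close> are real, hence
  signs because the support \<open>T\<close> is finite. An element of \<open>D k\<close>, \<open>k \<in> K\<close>, commuting with all these
  components can be rescaled to be central, so \<open>k = 0\<close>; therefore \<open>T\<close> is an elementary
  2-group and squares outside \<open>K\<close> are real. For \<open>k \<in> K\<close> choose \<open>Y \<in> D k\<close> with \<open>Y\<^sup>2 = 1\<close>: the sign by
  which \<open>Y\<close> commutes with any homogeneous element is a product of values of \<open>\<nu>\<close>. An isomorphism is
  then built up from \<open>\<complex>\<close> by adjoining one element \<open>X\<close> outside \<open>K\<close> with \<open>X\<^sup>2 = \<nu>(t) 1\<close> and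
  successively such elements \<open>Y\<close>.
\<close>

section \<open>Linear algebra and general facts on gradings\<close>

text \<open>Lets a commutation relation act inside right-associated products, so that simplification
  can move one factor of a longer word past another.\<close>

lemma mult_assoc_swap: "a * b = c * d \<Longrightarrow> a * (b * w) = c * (d * w)" for a :: "'a::semigroup_mult"
  by (metis mult.assoc)

lemma square_root_of_minus_one_not_real:
  fixes J :: "'a::real_algebra_1"
  assumes "J * J = -1"
  shows "J \<notin> range of_real"
proof
  assume "J \<in> range of_real"
  then obtain r where "J = of_real r" by blast
  then have "of_real (r * r) = (of_real (-1) :: 'a)" using assms by simp
  then have "r * r = -1" by (simp only: of_real_eq_iff)
  then show False using zero_le_square[of r] by linarith
qed

lemma span_of_independent_pair:
  fixes S :: "'a::real_vector set"
  assumes "dim S = 2" "x \<in> S" "y \<in> S" "independent {x, y}" "x \<noteq> y"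
  shows "S \<subseteq> span {x, y}"
proof
  fix z assume z: "z \<in> S"
  obtain B where B: "B \<subseteq> S" "independent B" "S \<subseteq> span B" "card B = dim S"
    by (rule real_vector.basis_exists)
  \<comment> \<open>An infinite set has \<open>card\<close> 0, so cardinality 2 forces
    finiteness.\<close>
  have "finite B"
    using B(4) assms(1) by (metis card.infinite zero_neq_numeral)
  show "z \<in> span {x, y}"
  proof (rule ccontr)
    assume nz: "z \<notin> span {x, y}"
    then have ind: "independent (insert z {x, y})"
      using assms(4) real_vector.span_base by (auto simp: real_vector.independent_insert)
    have "insert z {x, y} \<subseteq> span B"
      using B(3) z assms by blast
    from real_vector.independent_span_bound[OF \<open>finite B\<close> ind this]
    have "card (insert z {x, y}) \<le> 2" using B(4) assms(1) by simp
    moreover have "z \<noteq> x" "z \<noteq> y" using nz by (auto simp: real_vector.span_base)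
    ultimately show False using assms(5) by simp
  qed
qed

text \<open>Padding with zeros transfers the uniqueness in \<open>grading_def\<close>, stated for
  the exact set of nonzero terms, to any common finite index set.\<close>

lemma grading_decomposition_unique:
  assumes "grading D" and "\<And>g. f g \<in> D g" "\<And>g. f' g \<in> D g"
    and "finite A" "\<And>g. g \<notin> A \<Longrightarrow> f g = 0" "\<And>g. g \<notin> A \<Longrightarrow> f' g = 0"
    and "sum f A = sum f' A"
  shows "f = f'"
proof -
  have *: "finite {g. h g \<noteq> 0} \<and> sum h A = (\<Sum>g | h g \<noteq> 0. h g)"
    if "\<And>g. g \<notin> A \<Longrightarrow> h g = 0" for h :: "'a \<Rightarrow> 'b"
    using that assms(4)
    by (auto intro!: finite_subset[of "{g. h g \<noteq> 0}" A] sum.mono_neutral_right)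
  have "\<exists>!h. (\<forall>g. h g \<in> D g) \<and> finite {g. h g \<noteq> 0} \<and> sum f A = (\<Sum>g | h g \<noteq> 0. h g)"
    using assms(1) unfolding grading_def by blast
  then show ?thesis using *[of f] *[of f'] assms by (metis (no_types, lifting))
qed

text \<open>Nonzero elements, one from each nonzero component, are linearly independent, so a finite
  spanning set bounds their number.\<close>

lemma finite_grading_support:
  assumes gr: "grading (D :: 'g::group_add \<Rightarrow> 'a::real_algebra set)"
    and fd: "finite_dimensional_algebra TYPE('a)"
  shows "finite (grading_support D)"
proof -
  have sub: "subspace (D g)" for g using gr by (simp add: grading_def)
  have "\<forall>t\<in>grading_support D. \<exists>x. x \<in> D t \<and> x \<noteq> 0"
    using real_vector.subspace_0[OF sub] by (fastforce simp: grading_support_def)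
  then obtain X where X: "\<And>t. t \<in> grading_support D \<Longrightarrow> X t \<in> D t \<and> X t \<noteq> 0" by metis
  have zero: "u t = 0" if "finite A" "A \<subseteq> grading_support D" "t \<in> A"
    and "(\<Sum>t\<in>A. u t *\<^sub>R X t) = 0" for A u t
  proof -
    let ?f = "\<lambda>t. if t \<in> A then u t *\<^sub>R X t else 0"
    have "?f = (\<lambda>_. 0)"
      by (rule grading_decomposition_unique[OF gr _ _ that(1)])
        (use that X sub in \<open>auto simp: real_vector.subspace_0 real_vector.subspace_scale\<close>)
    then have "u t *\<^sub>R X t = 0" using that(3) by metis
    then show ?thesis using X that by auto
  qed
  have inj: "inj_on X (grading_support D)"
  proof (rule inj_onI, rule ccontr)
    fix s t assume st: "s \<in> grading_support D" "t \<in> grading_support D" "X s = X t" "s \<noteq> t"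
    have "(\<Sum>r\<in>{s, t}. (if r = s then 1 else -1) *\<^sub>R X r) = 0"
      using st by auto
    from zero[OF _ _ _ this, of s] st show False by simp
  qed
  have "independent (X ` grading_support D)"
    unfolding real_vector.dependent_explicit
  proof clarify
    fix U u v assume U: "finite U" "U \<subseteq> X ` grading_support D" "v \<in> U" "u v \<noteq> 0"
      and s: "(\<Sum>v\<in>U. u v *\<^sub>R v) = 0"
    define A where "A = {t \<in> grading_support D. X t \<in> U}"
    have UA: "U = X ` A" and iA: "inj_on X A" using U inj by (auto simp: A_def inj_on_def)
    have fA: "finite A" using U(1) UA iA by (simp add: finite_image_iff)
    have "(\<Sum>t\<in>A. u (X t) *\<^sub>R X t) = 0"
      using s unfolding UA by (subst (asm) sum.reindex[OF iA]) simp
    moreover obtain t where "t \<in> A" "v = X t" using U(3) UA by auto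
    ultimately show False using zero[OF fA, of t "\<lambda>t. u (X t)"] U(4) by (auto simp: A_def)
  qed
  moreover obtain B :: "'a set" where "finite B" "span B = UNIV"
    using fd unfolding finite_dimensional_algebra_def by blast
  ultimately have "finite (X ` grading_support D)"
    using real_vector.independent_span_bound by blast
  then show ?thesis using inj by (simp add: finite_image_iff)
qed

section \<open>Homogeneous elements of a division grading\<close>

locale complex_division_grading =
  fixes D :: "'g::ab_group_add \<Rightarrow> 'a::real_algebra_1 set"
  assumes two_dim_csa: "two_dim_division_graded_csa D"
begin

abbreviation T where "T \<equiv> grading_support D"
abbreviation K where "K \<equiv> neutral_centralizer_support D"

lemma gr: "grading D"
  and central: "{z::'a. \<forall>x. z * x = x * z} = range of_real"
  and dim_component: "t \<in> T \<Longrightarrow> dim (D t) = 2"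
  and inverse_ex: "x \<in> D t \<Longrightarrow> x \<noteq> 0 \<Longrightarrow> \<exists>y. x * y = 1 \<and> y * x = 1"
  using two_dim_csa
  unfolding two_dim_division_graded_csa_def division_grading_def central_algebra_def by blast+

lemma finite_T: "finite T"
  using two_dim_csa finite_grading_support
  unfolding two_dim_division_graded_csa_def division_grading_def by blast

lemma subspace_component: "subspace (D t)"
  and mult_closed: "x \<in> D s \<Longrightarrow> y \<in> D t \<Longrightarrow> x * y \<in> D (s + t)"
  using gr unfolding grading_def by blast+

lemma zero_component [simp]: "0 \<in> D t"
  and add_closed: "x \<in> D t \<Longrightarrow> y \<in> D t \<Longrightarrow> x + y \<in> D t"
  and scale_closed: "x \<in> D t \<Longrightarrow> c *\<^sub>R x \<in> D t"
  and diff_closed: "x \<in> D t \<Longrightarrow> y \<in> D t \<Longrightarrow> x - y \<in> D t"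
  using subspace_component
  by (simp_all add: real_vector.subspace_0 real_vector.subspace_add real_vector.subspace_scale
      real_vector.subspace_diff)

lemma support_iff: "t \<in> T \<longleftrightarrow> (\<exists>x\<in>D t. x \<noteq> 0)"
  using zero_component by (fastforce simp: grading_support_def)

lemma supportI: "x \<in> D t \<Longrightarrow> x \<noteq> 0 \<Longrightarrow> t \<in> T"
  using support_iff by blast

lemma left_cancel: "x \<in> D t \<Longrightarrow> x \<noteq> 0 \<Longrightarrow> x * y = x * z \<Longrightarrow> y = z"
  and right_cancel: "x \<in> D t \<Longrightarrow> x \<noteq> 0 \<Longrightarrow> y * x = z * x \<Longrightarrow> y = z"
  using inverse_ex[of x t] by (metis mult.assoc mult.left_neutral mult.right_neutral)+

lemma mult_nonzero: "x \<in> D t \<Longrightarrow> x \<noteq> 0 \<Longrightarrow> y \<noteq> 0 \<Longrightarrow> x * y \<noteq> 0"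
  using left_cancel[of x t y 0] by auto

lemma T_add: "s \<in> T \<Longrightarrow> t \<in> T \<Longrightarrow> s + t \<in> T"
  by (metis mult_closed mult_nonzero support_iff)

lemma decompose: "\<exists>f. (\<forall>g. f g \<in> D g) \<and> x = sum f T"
proof -
  have "\<exists>!f. (\<forall>g. f g \<in> D g) \<and> finite {g. f g \<noteq> 0} \<and> x = (\<Sum>g | f g \<noteq> 0. f g)"
    using gr unfolding grading_def by blast
  then obtain f where f: "\<And>g. f g \<in> D g" "x = (\<Sum>g | f g \<noteq> 0. f g)" by metis
  have "{g. f g \<noteq> 0} \<subseteq> T" using f(1) supportI by blast
  then have "(\<Sum>g | f g \<noteq> 0. f g) = sum f T"
    by (intro sum.mono_neutral_left) (auto simp: finite_T)
  then show ?thesis using f by metis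
qed

lemma decompose_unique:
  assumes "\<And>g. g \<in> T \<Longrightarrow> f g \<in> D g" "\<And>g. g \<in> T \<Longrightarrow> f' g \<in> D g" "sum f T = sum f' T" "g \<in> T"
  shows "f g = f' g"
proof -
  have "(\<lambda>g. if g \<in> T then f g else 0) = (\<lambda>g. if g \<in> T then f' g else 0)"
    by (rule grading_decomposition_unique[OF gr _ _ finite_T]) (use assms in auto)
  then show ?thesis using assms(4) by meson
qed

lemma components_disjoint: "x \<in> D s \<Longrightarrow> x \<in> D t \<Longrightarrow> x \<noteq> 0 \<Longrightarrow> s = t"
proof (rule ccontr)
  assume x: "x \<in> D s" "x \<in> D t" "x \<noteq> 0" "s \<noteq> t"
  have st: "s \<in> T" "t \<in> T" using x supportI by auto
  have "(if s = s then x else 0) = (if s = t then x else 0)"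
    by (rule decompose_unique[where f = "\<lambda>g. if g = s then x else 0"
          and f' = "\<lambda>g. if g = t then x else 0"])
      (use x st finite_T in auto)
  then show False using x by simp
qed

lemma commutes_if_commutes_components:
  assumes "\<And>t x. t \<in> T \<Longrightarrow> x \<in> D t \<Longrightarrow> z * x = x * z"
  shows "z * x = x * z"
proof -
  obtain f where f: "\<And>g. f g \<in> D g" "x = sum f T" using decompose[of x] by blast
  show ?thesis unfolding f(2) by (simp add: sum_distrib_left sum_distrib_right assms f(1))
qed

text \<open>Write \<open>1\<close> as a sum of homogeneous \<open>c g\<close> and multiply by a
  nonzero \<open>x\<close> of degree \<open>h\<close>: comparing the terms of degree
  \<open>h\<close> gives \<open>c 0 * x = x\<close>, hence \<open>c 0 = 1\<close>.\<close>

lemma one_component [simp]: "1 \<in> D 0"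
proof -
  obtain c where c: "\<And>g. c g \<in> D g" "1 = sum c T" using decompose[of 1] by blast
  have "T \<noteq> {}" using c(2) by auto
  then obtain h x where x: "x \<in> D h" "x \<noteq> 0" and h: "h \<in> T" using support_iff by blast
  \<comment> \<open>\<open>T\<close> is not yet known to contain \<open>0\<close>; translation by
    \<open>h\<close> permutes it because an injective self-map of a finite set is onto.\<close>
  have bij: "bij_betw (\<lambda>g. g + h) T T"
    unfolding bij_betw_def using h
    by (intro conjI endo_inj_surj finite_T) (auto intro!: inj_onI T_add)
  have eq: "(\<Sum>j\<in>T. c (j - h) * x) = (\<Sum>g\<in>T. c g * x)"
    by (subst sum.reindex_bij_betw[OF bij, symmetric]) simp
  have "(\<Sum>j\<in>T. c (j - h) * x) = (\<Sum>j\<in>T. if j = h then x else 0)"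
    unfolding eq using h finite_T by (simp add: sum_distrib_right[symmetric] c(2)[symmetric])
  then have "c (h - h) * x = (if h = h then x else 0)"
    by (rule decompose_unique[rotated 2])
      (use h x mult_closed[OF c(1) x(1)] in \<open>auto, metis diff_add_cancel\<close>)
  then have "c 0 = 1" using right_cancel[OF x, of "c 0" 1] by simp
  then show ?thesis using c(1)[of 0] by simp
qed

lemma zero_in_T [simp]: "0 \<in> T"
  by (rule supportI[of 1]) auto

lemma of_real_component [simp]: "of_real r \<in> D 0"
  unfolding of_real_def by (intro scale_closed) simp

lemma neutral_mult: "x \<in> D 0 \<Longrightarrow> y \<in> D t \<Longrightarrow> x * y \<in> D t"
  "y \<in> D t \<Longrightarrow> x \<in> D 0 \<Longrightarrow> y * x \<in> D t"
  using mult_closed[of x 0 y t] mult_closed[of y t x 0] by simp_all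

section \<open>The neutral component as a copy of \<complex>\<close>

lemma independent_mult_pair:
  assumes "u \<notin> range of_real" "x \<in> D t" "x \<noteq> 0"
  shows "independent {x, u * x}" "x \<noteq> u * x"
proof -
  have "u * x \<noteq> r *\<^sub>R x" for r
  proof
    assume "u * x = r *\<^sub>R x"
    then have "u * x = of_real r * x" by (simp add: scaleR_conv_of_real)
    then show False using right_cancel[OF assms(2,3)] assms(1) by blast
  qed
  note ne = this
  show "x \<noteq> u * x" using ne[of 1] by auto
  have "u * x \<notin> span {x}" using ne by (auto simp: real_vector.span_singleton)
  then have "independent {u * x, x}"
    using assms(3) by (auto simp: real_vector.independent_insert)
  then show "independent {x, u * x}" by (simp add: insert_commute)
qed

text \<open>A nonreal \<open>x\<close> in \<open>D 0\<close> satisfies a quadratic equation, and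
  completing the square gives \<open>w\<close> with real square \<open>r\<close>. If
  \<open>r\<close> were nonnegative, \<open>w * w - r\<close> would split into two nonzero factors
  with product zero.\<close>

lemma imaginary_unit_exists: "\<exists>J\<in>D 0. J * J = -1"
proof -
  have "\<exists>w. w \<in> D 0 \<and> w \<notin> range of_real"
  proof (rule ccontr)
    assume "\<not> ?thesis"
    then have "D 0 \<subseteq> span {1}" by (auto simp: real_vector.span_singleton of_real_def)
    then have "dim (D 0) \<le> card {1::'a}" by (intro real_vector.dim_le_card) auto
    then show False using dim_component[OF zero_in_T] by simp
  qed
  then obtain x where x: "x \<in> D 0" "x \<notin> range of_real" by blast
  have "D 0 \<subseteq> span {1, x}"
    using span_of_independent_pair[of "D 0" 1 x] dim_component[OF zero_in_T]
      independent_mult_pair[OF x(2), of 1 0] x by simp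
  then have "x * x \<in> span {1, x}" using neutral_mult x by blast
  then obtain a b where ab: "x * x = a *\<^sub>R 1 + b *\<^sub>R x"
    by (auto simp: real_vector.span_insert real_vector.span_singleton algebra_simps)
  define w where "w = x - (b/2) *\<^sub>R 1"
  define r where "r = a + b^2/4"
  have w: "w \<in> D 0" unfolding w_def by (intro diff_closed scale_closed x) simp
  have wr: "w * w = r *\<^sub>R 1"
    unfolding w_def r_def
    by (simp add: algebra_simps ab power2_eq_square) (simp add: scaleR_add_left[symmetric])
  have wn: "w \<noteq> of_real s" for s
  proof
    assume "w = of_real s"
    then have "x = of_real (s + b/2)" by (simp add: w_def of_real_def algebra_simps)
    then show False using x(2) by blast
  qed
  have "r < 0"
  proof (rule ccontr)
    assume "\<not> r < 0"
    then have "(w - of_real (sqrt r)) * (w + of_real (sqrt r)) = 0"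
      by (simp add: algebra_simps wr of_real_def)
    moreover have "w - of_real (sqrt r) \<in> D 0" "w - of_real (sqrt r) \<noteq> 0"
      using diff_closed[OF w] wn by auto
    ultimately have "w + of_real (sqrt r) = 0" using mult_nonzero by blast
    then show False using wn[of "- sqrt r"] by (simp add: eq_neg_iff_add_eq_0)
  qed
  then have "((1 / sqrt (-r)) *\<^sub>R w) * ((1 / sqrt (-r)) *\<^sub>R w) = -1"
    by (simp add: wr)
  then show ?thesis using scale_closed[OF w] by blast
qed

definition imag_unit where "imag_unit = (SOME J. J \<in> D 0 \<and> J * J = -1)"

lemma imag_unit: "imag_unit \<in> D 0" "imag_unit * imag_unit = -1"
proof -
  have "imag_unit \<in> D 0 \<and> imag_unit * imag_unit = -1"
    unfolding imag_unit_def by (rule someI_ex) (use imaginary_unit_exists in blast)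
  then show "imag_unit \<in> D 0" "imag_unit * imag_unit = -1" by auto
qed

lemmas imag_unit_not_real = square_root_of_minus_one_not_real[OF imag_unit(2)]

text \<open>The identification of \<complex> with the neutral component; left multiplication by its
  values makes every component a complex vector space.\<close>

definition \<iota> :: "complex \<Rightarrow> 'a" where "\<iota> z = Re z *\<^sub>R 1 + Im z *\<^sub>R imag_unit"

lemma \<iota>_component: "\<iota> z \<in> D 0"
  unfolding \<iota>_def by (intro add_closed scale_closed imag_unit one_component)

lemma \<iota>_mult: "\<iota> (z * w) = \<iota> z * \<iota> w"
  by (simp add: \<iota>_def algebra_simps imag_unit)

lemma \<iota>_add: "\<iota> (z + w) = \<iota> z + \<iota> w"
  and \<iota>_scale: "\<iota> (c *\<^sub>R z) = c *\<^sub>R \<iota> z"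
  and \<iota>_of_real: "\<iota> (of_real c) = c *\<^sub>R 1"
  and \<iota>_1: "\<iota> 1 = 1"
  and \<iota>_0 [simp]: "\<iota> 0 = 0"
  and \<iota>_i: "\<iota> \<i> = imag_unit"
  by (simp_all add: \<iota>_def algebra_simps)

lemma \<iota>_eq_0: "\<iota> z = 0 \<longleftrightarrow> z = 0"
proof
  assume z: "\<iota> z = 0"
  show "z = 0"
  proof (rule ccontr)
    assume "z \<noteq> 0"
    then have "\<iota> (inverse z) * \<iota> z = 1" by (simp add: \<iota>_mult[symmetric] \<iota>_1)
    then show False using z by simp
  qed
qed (simp add: \<iota>_def)

lemma \<iota>_inject: "\<iota> z = \<iota> w \<longleftrightarrow> z = w"
proof -
  have "\<iota> (z - w) = \<iota> z - \<iota> w" by (simp add: \<iota>_def algebra_simps)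
  then show ?thesis using \<iota>_eq_0[of "z - w"] by auto
qed

text \<open>\<open>x\<close> and \<open>imag_unit * x\<close> form a real basis of the component,
  which is therefore a complex line.\<close>

lemma component_eq:
  assumes "x \<in> D t" "x \<noteq> 0" "y \<in> D t"
  obtains z where "y = \<iota> z * x"
proof -
  have "D t \<subseteq> span {x, imag_unit * x}"
    using assms imag_unit independent_mult_pair[OF imag_unit_not_real assms(1,2)]
    by (intro span_of_independent_pair dim_component supportI[of x] neutral_mult)
  then have "y \<in> span {x, imag_unit * x}" using assms by blast
  then obtain a b where "y = a *\<^sub>R x + b *\<^sub>R (imag_unit * x)"
    by (auto simp: real_vector.span_insert real_vector.span_singleton algebra_simps)
  then show ?thesis using that[of "Complex a b"] by (simp add: \<iota>_def algebra_simps)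
qed

lemma neutral_component_eq: "y \<in> D 0 \<Longrightarrow> \<exists>z. y = \<iota> z"
  using component_eq[of 1 0 y] by (metis mult.right_neutral one_component zero_neq_one)

section \<open>The centralizer of the neutral component and complex conjugation\<close>

lemma K_iff: "t \<in> K \<longleftrightarrow> (\<exists>x\<in>D t. x \<noteq> 0 \<and> (\<forall>y\<in>D 0. x * y = y * x))"
  unfolding neutral_centralizer_support_def grading_support_def centralizer_def
  using zero_component by fastforce

lemma K_subset_T: "t \<in> K \<Longrightarrow> t \<in> T"
  using K_iff supportI by blast

text \<open>One nonzero element of degree \<open>t\<close> centralizes \<complex>; all others are
  complex multiples of it, and \<complex> is commutative.\<close>

lemma K_commute:
  assumes "t \<in> K" "x \<in> D t"
  shows "x * \<iota> z = \<iota> z * x"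
proof -
  obtain y where y: "y \<in> D t" "y \<noteq> 0" "\<forall>z\<in>D 0. y * z = z * y" using assms(1) K_iff by blast
  obtain w where w: "x = \<iota> w * y" using component_eq y assms(2) by blast
  have "x * \<iota> z = \<iota> w * \<iota> z * y" using y(3) \<iota>_component w by (simp add: mult.assoc)
  also have "\<iota> w * \<iota> z = \<iota> z * \<iota> w" by (simp only: \<iota>_mult[symmetric] mult.commute[of w z])
  finally show ?thesis by (simp add: w mult.assoc)
qed

text \<open>Conjugation by a nonzero \<open>x\<close> sends \<open>imag_unit\<close> to a square
  root of \<open>-1\<close> in the copy of \<complex>, so to plus or minus itself; the plus sign
  would put \<open>t\<close> into \<open>K\<close>.\<close>

lemma anti_commute:
  assumes "t \<notin> K" "x \<in> D t"
  shows "x * \<iota> z = \<iota> (cnj z) * x"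
proof (cases "x = 0")
  case False
  have "x * imag_unit \<in> D t" using assms imag_unit by (intro neutral_mult)
  then obtain w where w: "x * imag_unit = \<iota> w * x" using component_eq assms False by blast
  have "\<iota> (w * w) * x = x * imag_unit * imag_unit"
    by (simp add: w \<iota>_mult mult.assoc)
  also have "\<dots> = \<iota> (- 1) * x" by (simp add: mult.assoc imag_unit \<iota>_def)
  finally have "\<iota> (w * w) = \<iota> (- 1)" using right_cancel[OF assms(2) False] by blast
  then have "w * w = \<i> * \<i>" by (simp add: \<iota>_inject)
  then have "w = \<i> \<or> w = -\<i>" by (simp only: square_eq_iff)
  moreover have "w \<noteq> \<i>"
  proof
    assume "w = \<i>"
    then have "x * y = y * x" if "y \<in> D 0" for y
      using neutral_component_eq[OF that] w by (auto simp: \<iota>_def algebra_simps)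
    then show False using K_iff assms False by blast
  qed
  ultimately show ?thesis using w by (auto simp: \<iota>_def algebra_simps)
qed simp

lemma K_iff_commute:
  assumes "x \<in> D t" "x \<noteq> 0"
  shows "t \<in> K \<longleftrightarrow> x * imag_unit = imag_unit * x"
proof
  show "t \<in> K \<Longrightarrow> x * imag_unit = imag_unit * x"
    using K_commute[of t x \<i>] assms by (simp add: \<iota>_def)
  assume c: "x * imag_unit = imag_unit * x"
  show "t \<in> K"
  proof (rule ccontr)
    assume "t \<notin> K"
    then have "\<iota> (cnj \<i>) * x = \<iota> \<i> * x" using anti_commute[of t x \<i>] assms c by (simp add: \<iota>_def)
    then have "\<iota> (cnj \<i>) = \<iota> \<i>" using right_cancel assms by blast
    then show False by (simp add: \<iota>_inject)
  qed
qed

text \<open>Conjugation by homogeneous elements defines a homomorphism from \<open>T\<close> to the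
  two-element group of real automorphisms of \<complex>, and \<open>K\<close> is its kernel.\<close>

lemma K_add:
  assumes "s \<in> T" "t \<in> T"
  shows "s + t \<in> K \<longleftrightarrow> (s \<in> K \<longleftrightarrow> t \<in> K)"
proof -
  obtain x y where x: "x \<in> D s" "x \<noteq> 0" and y: "y \<in> D t" "y \<noteq> 0" using assms support_iff by blast
  \<comment> \<open>The image of \<open>\<i>\<close> under the automorphism attached to degree
    \<open>t\<close>.\<close>
  let ?f = "\<lambda>t. if t \<in> K then \<i> else cnj \<i>"
  have comm: "x * imag_unit = \<iota> (?f s) * x" if "x \<in> D s" for x s
    using K_commute[of s x \<i>] anti_commute[of s x \<i>] that by (simp add: \<iota>_i)
  have cc: "x * \<iota> (?f t) = \<iota> (if s \<in> K then ?f t else cnj (?f t)) * x"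
    using K_commute[of s x "?f t"] anti_commute[of s x "?f t"] x by simp
  have xy: "x * y \<in> D (s + t)" "x * y \<noteq> 0" using mult_closed mult_nonzero x y by auto
  have "\<iota> (?f (s + t)) * (x * y) = x * (y * imag_unit)"
    using comm[OF xy(1)] by (simp add: mult.assoc)
  also have "\<dots> = \<iota> (if s \<in> K then ?f t else cnj (?f t)) * (x * y)"
    by (simp only: comm[OF y(1)] cc mult.assoc[symmetric])
  finally have "?f (s + t) = (if s \<in> K then ?f t else cnj (?f t))"
    using right_cancel[OF xy] \<iota>_inject by blast
  then show ?thesis by (auto split: if_splits simp: complex_eq_iff)
qed

text \<open>Otherwise \<open>imag_unit\<close> would be central without being real.\<close>

lemma not_K_exists: "\<exists>t\<in>T. t \<notin> K"
proof (rule ccontr)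
  assume "\<not> ?thesis"
  then have "imag_unit * x = x * imag_unit" if "t \<in> T" "x \<in> D t" for t x
    using K_commute[of t x \<i>] that by (simp add: \<iota>_i)
  then have "imag_unit * x = x * imag_unit" for x
    by (rule commutes_if_commutes_components)
  then show False using imag_unit_not_real central by blast
qed

section \<open>Commutators of homogeneous elements\<close>

lemma commutator:
  assumes "x \<in> D s" "y \<in> D t" "x \<noteq> 0" "y \<noteq> 0"
  obtains c where "c \<noteq> 0" "x * y = \<iota> c * (y * x)"
proof -
  have "y * x \<in> D (s + t)" "y * x \<noteq> 0"
    using mult_closed[of y t x s] mult_nonzero[of y t x] assms by (simp_all add: add.commute)
  then obtain c where c: "x * y = \<iota> c * (y * x)"
    using component_eq mult_closed[OF assms(1,2)] by blast
  moreover have "c \<noteq> 0" using c mult_nonzero[OF assms(1,3,4)] by (auto simp: \<iota>_eq_0)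
  ultimately show ?thesis using that by blast
qed

text \<open>Pigeonhole in the finite set \<open>T\<close>; the iterates are the multiples of
  \<open>k\<close>, which are the degrees of the powers of an element of \<open>D k\<close>.\<close>

lemma T_degree_repeats:
  assumes "k \<in> T"
  obtains m n where "m < n" "((+) k ^^ m) 0 = ((+) k ^^ n) 0"
proof -
  have "((+) k ^^ n) 0 \<in> T" for n by (induction n) (auto intro: T_add assms)
  then have "finite (range (\<lambda>n. ((+) k ^^ n) 0))"
    using finite_T by (meson finite_subset image_subsetI)
  then have "\<not> inj (\<lambda>n. ((+) k ^^ n) 0)"
    using finite_imageD infinite_UNIV_nat by blast
  then obtain m n where mn: "((+) k ^^ m) 0 = ((+) k ^^ n) 0" "m \<noteq> n"
    unfolding inj_def by blast
  then show ?thesis using that[of m n] that[of n m] by (metis linorder_neqE_nat)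
qed

text \<open>Move an \<open>X\<close> of degree outside \<open>K\<close> through \<open>Y * Z\<close>
  directly, and again after rewriting this product as \<open>\<iota> b * (Z * Y)\<close>. The
  factors agree except that \<open>X\<close> turns \<open>b\<close> into \<open>cnj b\<close> the
  second time.\<close>

lemma K_commutator_real:
  assumes "k \<in> K" "l \<in> K" "Y \<in> D k" "Z \<in> D l" "Y \<noteq> 0" "Z \<noteq> 0" and b: "Y * Z = \<iota> b * (Z * Y)"
  shows "cnj b = b"
proof -
  obtain t X where t: "t \<notin> K" and X: "X \<in> D t" "X \<noteq> 0" using not_K_exists support_iff by blast
  obtain c where c: "c \<noteq> 0" "X * Y = \<iota> c * (Y * X)" using commutator X assms by blast
  obtain d where d: "d \<noteq> 0" "X * Z = \<iota> d * (Z * X)" using commutator X assms by blast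
  have YX: "Y * X \<in> D (k + t)" "Y * X \<noteq> 0" using mult_closed mult_nonzero assms X by blast+
  have ZYX: "Z * (Y * X) \<in> D (l + (k + t))" "Z * (Y * X) \<noteq> 0"
    using mult_closed[OF assms(4) YX(1)] mult_nonzero[OF assms(4) assms(6) YX(2)] .
  have "X * (Y * Z) = \<iota> c * (Y * (X * Z))"
    by (simp add: mult_assoc_swap[OF c(2)] mult.assoc)
  also have "\<dots> = \<iota> c * (\<iota> d * (Y * (Z * X)))"
    by (simp add: d(2) mult_assoc_swap[OF K_commute[OF assms(1,3)]])
  also have "\<dots> = \<iota> (c * d * b) * (Z * (Y * X))"
    by (simp add: mult_assoc_swap[OF b] \<iota>_mult mult.assoc)
  finally have 1: "X * (Y * Z) = \<iota> (c * d * b) * (Z * (Y * X))" .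
  have "X * (Y * Z) = \<iota> (cnj b) * (X * Z * Y)"

    by (simp add: b mult_assoc_swap[OF anti_commute[OF t X(1)]] mult.assoc)
  also have "\<dots> = \<iota> (cnj b) * (\<iota> d * (Z * (X * Y)))" by (simp add: d(2) mult.assoc)
  also have "\<dots> = \<iota> (cnj b) * (\<iota> d * (\<iota> c * (Z * (Y * X))))"
    by (simp add: c(2) mult_assoc_swap[OF K_commute[OF assms(2,4)]])
  also have "\<dots> = \<iota> (cnj b * d * c) * (Z * (Y * X))" by (simp add: \<iota>_mult mult.assoc)
  finally have "\<iota> (c * d * b) = \<iota> (cnj b * d * c)" using 1 right_cancel[OF ZYX] by simp
  then show ?thesis using c d by (simp add: \<iota>_inject)
qed

text \<open>The factor \<open>b\<close> is real, and \<open>Y ^ n\<close> commutes with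
  \<open>Z\<close> up to \<open>b ^ n\<close>. Two different powers of \<open>Y\<close> share a
  degree, so they differ by a complex scalar, which commutes with \<open>Z\<close>; hence
  \<open>b\<close> is a root of unity.\<close>

lemma K_commutator_sign:
  assumes "k \<in> K" "l \<in> K" "Y \<in> D k" "Z \<in> D l"
  obtains e :: real where "e = 1 \<or> e = -1" "Y * Z = e *\<^sub>R (Z * Y)"
proof (cases "Y = 0 \<or> Z = 0")
  case False
  then obtain b where b: "b \<noteq> 0" "Y * Z = \<iota> b * (Z * Y)" using commutator assms by blast
  have real: "cnj b = b" using K_commutator_real[OF assms _ _ b(2)] False by blast
  have pow: "Y ^ n * Z = \<iota> (b ^ n) * (Z * Y ^ n)" for n
  proof (induction n)
    case (Suc n)
    have "Y ^ Suc n * Z = Y * (\<iota> (b ^ n) * (Z * Y ^ n))" using Suc by (simp add: mult.assoc)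
    also have "\<dots> = \<iota> (b ^ n) * (Y * Z * Y ^ n)"
      by (simp add: mult_assoc_swap[OF K_commute[OF assms(1,3)]] mult.assoc)
    also have "\<dots> = \<iota> (b ^ n * b) * (Z * Y * Y ^ n)" using b by (simp add: \<iota>_mult mult.assoc)
    finally show ?case by (simp add: mult.assoc mult.commute[of b])
  qed (simp add: \<iota>_1)
  have Yn: "Y ^ n \<in> D (((+) k ^^ n) 0)" "Y ^ n \<noteq> 0" for n
    by (induction n) (use mult_closed mult_nonzero assms False in auto)
  obtain m n where mn: "m < n" "((+) k ^^ m) 0 = ((+) k ^^ n) 0"
    using T_degree_repeats K_subset_T assms(1) by blast
  obtain d where d: "Y ^ n = \<iota> d * Y ^ m" using component_eq Yn mn(2) by metis
  have ZY: "Z * Y ^ n \<in> D (l + ((+) k ^^ n) 0)" "Z * Y ^ n \<noteq> 0"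
    using mult_closed[OF assms(4) Yn(1)] mult_nonzero[OF assms(4) _ Yn(2)] False by auto
  have "\<iota> (b ^ n) * (Z * Y ^ n) = \<iota> d * (Y ^ m * Z)" using pow[of n] d by (simp add: mult.assoc)
  also have "\<dots> = \<iota> (d * b ^ m) * (Z * Y ^ m)" by (simp add: pow \<iota>_mult mult.assoc)
  also have "\<dots> = \<iota> (b ^ m) * (\<iota> d * (Z * Y ^ m))"
    by (simp only: mult.commute[of d] \<iota>_mult mult.assoc)
  also have "\<dots> = \<iota> (b ^ m) * (Z * Y ^ n)"
    by (simp add: d mult_assoc_swap[OF K_commute[OF assms(2,4)]])
  finally have "\<iota> (b ^ n) = \<iota> (b ^ m)" using right_cancel[OF ZY] by blast
  then have "b ^ (n - m) = 1" using b(1) mn(1) by (simp add: \<iota>_inject power_diff)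
  then have "norm b ^ (n - m) = 1" by (metis norm_one norm_power)
  then have "norm b = 1" using mn(1) power_eq_imp_eq_base[of "norm b" "n - m" 1] by simp
  moreover obtain r where r: "b = of_real r" using real by (metis Reals_cases Reals_cnj_iff)
  ultimately have "r = 1 \<or> r = -1" by (simp add: abs_if split: if_splits)
  moreover have "Y * Z = r *\<^sub>R (Z * Y)" using b(2) r by (simp add: \<iota>_of_real)
  ultimately show ?thesis using that by blast
qed (use that[of 1] in auto)

section \<open>Nondegeneracy on \<open>K\<close> and exponent two\<close>

text \<open>A complex multiple of \<open>Y\<close> commutes also with one \<open>X\<close> of degree
  outside \<open>K\<close>. It is then central, hence real, so its degree is
  \<open>0\<close>.\<close>

lemma K_nondegenerate:
  assumes k: "k \<in> K" and Y: "Y \<in> D k" "Y \<noteq> 0"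
    and comm: "\<And>l Z. l \<in> K \<Longrightarrow> Z \<in> D l \<Longrightarrow> Y * Z = Z * Y"
  shows "k = 0"
proof -
  obtain t X where t: "t \<notin> K" and X: "X \<in> D t" "X \<noteq> 0" using not_K_exists support_iff by blast
  note tT = supportI[OF X]
  obtain c where c: "c \<noteq> 0" "X * Y = \<iota> c * (Y * X)" using commutator X Y by blast
  have YX: "Y * X \<in> D (k + t)" "Y * X \<noteq> 0" using mult_closed mult_nonzero Y X by blast+
  have YXX: "Y * X * X \<in> D (k + t + t)" "Y * X * X \<noteq> 0"
    using mult_closed[OF YX(1) X(1)] mult_nonzero[OF YX X(2)] .
  \<comment> \<open>\<open>X * X\<close> has degree in \<open>K\<close>, so \<open>Y\<close>
    commutes with it; passing \<open>Y\<close> through the two factors one at a time shows that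
    \<open>cnj c * c\<close> is 1.\<close>
  have "Y * X * X = X * X * Y"
    using comm[of "t + t" "X * X"] mult_closed[OF X(1) X(1)] t tT K_add[of t t]
    by (simp add: mult.assoc)
  also have "\<dots> = \<iota> (cnj c) * (X * Y) * X"
    by (simp add: c(2) mult_assoc_swap[OF c(2)] mult_assoc_swap[OF anti_commute[OF t X(1)]] mult.assoc)
  also have "\<dots> = \<iota> (cnj c * c) * (Y * X * X)" using c(2) by (simp add: \<iota>_mult mult.assoc)
  finally have "\<iota> 1 * (Y * X * X) = \<iota> (cnj c * c) * (Y * X * X)" by (simp add: \<iota>_1)
  then have cc: "cnj c * c = 1" using right_cancel[OF YXX] \<iota>_inject by metis
  \<comment> \<open>Hilbert 90 for \<open>\<complex>/\<real>\<close>\<close>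
  define z where "z = (if c = -1 then \<i> else 1 + c)"
  have z: "z \<noteq> 0" "cnj z * c = z"
    using cc by (auto simp: z_def algebra_simps add_eq_0_iff2 dest: minus_equation_iff[THEN iffD1])
  define W where "W = \<iota> z * Y"
  have W: "W \<in> D k" "W \<noteq> 0"
    using neutral_mult(1)[OF \<iota>_component Y(1)] mult_nonzero[OF \<iota>_component _ Y(2)] z
    by (auto simp: W_def \<iota>_eq_0)
  have "X * W = \<iota> (cnj z * c) * (Y * X)"
    by (simp add: W_def c(2) mult_assoc_swap[OF anti_commute[OF t X(1)]] \<iota>_mult mult.assoc)
  then have XW: "X * W = W * X" by (simp add: z W_def mult.assoc)
  have WK: "W * Z = Z * W" if "l \<in> K" "Z \<in> D l" for l Z
    by (simp add: W_def comm[OF that] mult_assoc_swap[OF K_commute[OF that]] mult.assoc)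
  have "W * Z = Z * W" if "l \<in> T" "Z \<in> D l" for l Z
  proof (cases "l \<in> K")
    case False
    \<comment> \<open>The degrees of \<open>X\<close> and \<open>Z\<close> both lie outside
      \<open>K\<close>, so that of \<open>X * Z\<close> lies in \<open>K\<close>; cancelling
      \<open>X\<close> then gives the claim for \<open>Z\<close>.\<close>
    then have "W * (X * Z) = X * Z * W"
      using WK[of "t + l"] mult_closed[OF X(1) that(2)] K_add[OF tT that(1)] t by blast
    then have "X * (W * Z) = X * (Z * W)" by (simp add: mult_assoc_swap[OF XW] mult.assoc)
    then show ?thesis using left_cancel X by blast
  qed (use WK that in blast)
  then have "W * x = x * W" for x by (rule commutes_if_commutes_components)
  then have "W \<in> range of_real" using central by blast
  then have "W \<in> D 0" by auto
  then show ?thesis using components_disjoint W by blast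
qed

text \<open>Elements with degrees in \<open>K\<close> commute up to sign, so \<open>Y * Y\<close>
  commutes with all of them and nondegeneracy applies to it.\<close>

lemma K_double: "k + k = 0" if k: "k \<in> K"
proof -
  obtain Y where Y: "Y \<in> D k" "Y \<noteq> 0" using k K_subset_T support_iff by blast
  have "Y * Y * Z = Z * (Y * Y)" if Z: "l \<in> K" "Z \<in> D l" for l Z
  proof -
    obtain e :: real where e: "e = 1 \<or> e = -1" "Y * Z = e *\<^sub>R (Z * Y)"
      using K_commutator_sign[OF k Z(1) Y(1) Z(2)] by blast
    have "Y * Y * Z = Y * (e *\<^sub>R (Z * Y))" by (simp add: e(2)[symmetric] mult.assoc)
    also have "\<dots> = e *\<^sub>R (Y * Z * Y)" by (simp add: mult.assoc)
    also have "Y * Z * Y = e *\<^sub>R (Z * Y * Y)" by (simp add: e(2))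
    also have "e *\<^sub>R e *\<^sub>R (Z * Y * Y) = Z * (Y * Y)" using e(1) by (auto simp: mult.assoc)
    finally show ?thesis .
  qed
  then show ?thesis
    using K_nondegenerate[of "k + k" "Y * Y"] K_add[of k k] k K_subset_T[OF k] mult_closed Y mult_nonzero
    by blast
qed

text \<open>For \<open>t\<close> outside \<open>K\<close>, passing \<open>X * X\<close> through
  \<open>Z\<close> gives the nonnegative factor \<open>cnj c * c\<close>. Commutators with degrees
  in \<open>K\<close> are signs, so this factor is 1 and nondegeneracy applies to
  \<open>X * X\<close>.\<close>

lemma T_double: "t + t = 0" if tT: "t \<in> T"
proof (cases "t \<in> K")
  case False
  obtain X where X: "X \<in> D t" "X \<noteq> 0" using tT support_iff by blast
  have tt: "t + t \<in> K" using K_add[OF tT tT] by simp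
  have XX: "X * X \<in> D (t + t)" "X * X \<noteq> 0" using mult_closed mult_nonzero X by blast+
  have "X * X * Z = Z * (X * X)" if Z: "l \<in> K" "Z \<in> D l" for l Z
  proof (cases "Z = 0")
    case False
    obtain c where c: "c \<noteq> 0" "X * Z = \<iota> c * (Z * X)" using commutator X Z False by blast
    obtain e :: real where e: "e = 1 \<or> e = -1" "X * X * Z = e *\<^sub>R (Z * (X * X))"
      using K_commutator_sign[OF tt Z(1) XX(1) Z(2)] by blast
    have ZXX: "Z * (X * X) \<in> D (l + (t + t))" "Z * (X * X) \<noteq> 0"
      using mult_closed[OF Z(2) XX(1)] mult_nonzero[OF Z(2) False XX(2)] .
    have "\<iota> (of_real e) * (Z * (X * X)) = X * (X * Z)" using e(2) by (simp add: \<iota>_of_real mult.assoc)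
    also have "\<dots> = \<iota> (cnj c) * (X * Z) * X"
      by (simp add: c(2) mult_assoc_swap[OF c(2)] mult_assoc_swap[OF anti_commute[OF \<open>t \<notin> K\<close> X(1)]] mult.assoc)
    also have "\<dots> = \<iota> (cnj c * c) * (Z * (X * X))" using c(2) by (simp add: \<iota>_mult mult.assoc)
    finally have "of_real e = cnj c * c" using right_cancel[OF ZXX] \<iota>_inject by blast
    then have "e = (norm c)\<^sup>2"
      by (metis complex_norm_square mult.commute of_real_eq_iff)
    then have "e \<ge> 0" by simp
    then show ?thesis using e by auto
  qed simp
  then show ?thesis using K_nondegenerate[OF tt XX] by blast
qed (use K_double in blast)

section \<open>Squares of homogeneous elements and the sign map\<close>

text \<open>\<open>X * X\<close> is a complex scalar commuting with \<open>X\<close>, while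
  \<open>X\<close> induces complex conjugation, so the scalar is real.\<close>

lemma square_real:
  assumes "t \<notin> K" "X \<in> D t" "X \<noteq> 0"
  obtains r :: real where "r \<noteq> 0" "X * X = r *\<^sub>R 1"
proof -
  have XX: "X * X \<in> D 0" "X * X \<noteq> 0"
    using mult_closed[of X t X t] mult_nonzero[of X t X] assms T_double[of t] supportI by auto
  then obtain z where z: "X * X = \<iota> z" using neutral_component_eq by blast
  have "\<iota> (cnj z) * X = X * \<iota> z" using anti_commute[OF assms(1,2)] by simp
  also have "\<dots> = \<iota> z * X" by (simp add: z[symmetric] mult.assoc)
  finally have "cnj z = z" using right_cancel[OF assms(2,3)] \<iota>_inject by blast
  then obtain r where "z = of_real r" by (metis Reals_cases Reals_cnj_iff)
  then have "X * X = r *\<^sub>R 1" using z by (simp add: \<iota>_of_real)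
  then show ?thesis using that XX(2) by auto
qed

text \<open>Any other nonzero element is \<open>\<iota> w * X\<close>, whose square is that of
  \<open>X\<close> times the positive number \<open>w * cnj w\<close>, so the sign depends on
  \<open>t\<close> only. Off \<open>T - K\<close> uniqueness is extensionality.\<close>

lemma ex1_square_sign_map: "\<exists>!\<nu>. square_sign_map D \<nu>"
proof -
  have "\<exists>s\<in>{1,-1}. \<forall>X\<in>D t. X \<noteq> 0 \<longrightarrow> (\<exists>c>0. X ^ 2 = c *\<^sub>R (s *\<^sub>R (1::'a)))"
    if t: "t \<in> T - K" for t
  proof -
    obtain X where X: "X \<in> D t" "X \<noteq> 0" using t support_iff by blast
    obtain r where r: "r \<noteq> 0" "X * X = r *\<^sub>R 1" using square_real t X by blast
    have "\<exists>c>0. Z ^ 2 = c *\<^sub>R (sgn r *\<^sub>R (1::'a))" if Z: "Z \<in> D t" "Z \<noteq> 0" for Z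
    proof -
      obtain w where w: "Z = \<iota> w * X" using component_eq X Z by blast
      then have "w \<noteq> 0" using Z(2) by (auto simp: \<iota>_eq_0)
      have "Z ^ 2 = \<iota> w * (X * \<iota> w) * X" by (simp add: w power2_eq_square mult.assoc)
      also have "\<dots> = \<iota> (w * cnj w) * (X * X)"
        using anti_commute[of t X w] t X by (simp add: \<iota>_mult mult.assoc)
      also have "\<dots> = ((norm w)\<^sup>2 * r) *\<^sub>R 1"
        by (simp only: complex_norm_square[symmetric] \<iota>_of_real r(2)) simp
      also have "\<dots> = ((norm w)\<^sup>2 * \<bar>r\<bar>) *\<^sub>R (sgn r *\<^sub>R 1)"
        by (simp add: abs_mult_sgn mult.assoc)
      finally show ?thesis using r(1) \<open>w \<noteq> 0\<close> by (intro exI[of _ "(norm w)\<^sup>2 * \<bar>r\<bar>"]) auto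
    qed
    then show ?thesis using r(1) by (intro bexI[of _ "sgn r"]) (auto simp: sgn_if)
  qed
  then have "\<forall>t\<in>T - K. \<exists>s\<in>{1,-1}. \<forall>X\<in>D t. X \<noteq> 0 \<longrightarrow> (\<exists>c>0. X ^ 2 = c *\<^sub>R (s *\<^sub>R (1::'a)))"
    by blast
  then obtain \<nu> where \<nu>: "\<forall>t\<in>T - K. \<nu> t \<in> {1,-1} \<and>
      (\<forall>X\<in>D t. X \<noteq> 0 \<longrightarrow> (\<exists>c>0. X ^ 2 = c *\<^sub>R (\<nu> t *\<^sub>R (1::'a))))" by metis
  have "square_sign_map D (restrict \<nu> (T - K))" using \<nu> by (auto simp: square_sign_map_def)
  moreover have "\<mu> = \<mu>'" if m: "square_sign_map D \<mu>" "square_sign_map D \<mu>'" for \<mu> \<mu>'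
  proof (rule PiE_ext)
    show "\<mu> \<in> (T - K) \<rightarrow>\<^sub>E {1, -1}" "\<mu>' \<in> (T - K) \<rightarrow>\<^sub>E {1, -1}"
      using m by (auto simp: square_sign_map_def)
    then have vals: "\<mu> t \<in> {1, -1}" "\<mu>' t \<in> {1, -1}" if "t \<in> T - K" for t
      using PiE_mem[OF _ that] by blast+
    fix t assume t: "t \<in> T - K"
    then obtain X where X: "X \<in> D t" "X \<noteq> 0" using support_iff by blast
    obtain c c' where c: "c > 0" "c' > 0"
      "X ^ 2 = c *\<^sub>R (\<mu> t *\<^sub>R 1)" "X ^ 2 = c' *\<^sub>R (\<mu>' t *\<^sub>R 1)"
      using m t X unfolding square_sign_map_def by metis
    then have "(c * \<mu> t) *\<^sub>R (1::'a) = (c' * \<mu>' t) *\<^sub>R 1" by simp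
    then have "c * \<mu> t = c' * \<mu>' t" by (simp only: real_vector.scale_right_imp_eq[OF one_neq_zero])
    then show "\<mu> t = \<mu>' t" using c(1,2) vals[OF t] by auto
  qed
  ultimately show ?thesis by blast
qed

text \<open>Inside \<open>K\<close> scalars commute with \<open>X\<close>, so
  \<open>\<iota> w * X\<close> has square \<open>w * w\<close> times that of \<open>X\<close>, and
  \<complex> has square roots.\<close>

lemma square_one_exists:
  assumes "k \<in> K"
  obtains Y where "Y \<in> D k" "Y * Y = 1"
proof -
  obtain X where X: "X \<in> D k" "X \<noteq> 0" using assms K_subset_T support_iff by blast
  have XX: "X * X \<in> D 0" "X * X \<noteq> 0"
    using mult_closed[of X k X k] mult_nonzero[of X k X] X K_double[OF assms] by auto
  then obtain z where z: "X * X = \<iota> z" using neutral_component_eq by blast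
  define w where "w = inverse (csqrt z)"
  have "z \<noteq> 0" using z XX(2) by (auto simp: \<iota>_eq_0)
  then have w: "w * w * z = 1"
    using power2_csqrt[of z] by (simp add: w_def power2_eq_square field_simps)
  have "\<iota> w * X * (\<iota> w * X) = \<iota> (w * w) * (X * X)"
    by (simp add: \<iota>_mult mult_assoc_swap[OF K_commute[OF assms X(1)]] mult.assoc)
  also have "\<dots> = 1" by (simp add: z \<iota>_mult[symmetric] w \<iota>_1)
  finally show ?thesis using that neutral_mult \<iota>_component X by blast
qed

lemma square_one_exists_not_K:
  assumes \<nu>: "square_sign_map D \<nu>" and t: "t \<in> T - K"
  obtains X where "X \<in> D t" "X * X = \<nu> t *\<^sub>R 1"
proof -
  obtain X where X: "X \<in> D t" "X \<noteq> 0" using t support_iff by blast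
  then obtain c where c: "c > 0" "X ^ 2 = c *\<^sub>R (\<nu> t *\<^sub>R 1)"
    using \<nu> t unfolding square_sign_map_def by blast
  then have "((1 / sqrt c) *\<^sub>R X) * ((1 / sqrt c) *\<^sub>R X) = \<nu> t *\<^sub>R 1"
    by (simp add: power2_eq_square real_sqrt_mult_self)
  then show ?thesis using that scale_closed X by blast
qed

lemma sign_values:
  assumes "square_sign_map D \<nu>" "t \<in> T - K"
  shows "\<nu> t = 1 \<or> \<nu> t = -1"
  using assms PiE_mem[of \<nu> "T - K" "\<lambda>_. {1, -1}" t] unfolding square_sign_map_def by auto

section \<open>Commutation signs expressed through \<nu>\<close>

text \<open>Since \<open>Y * Y = 1\<close>, the commutation factor is a sign \<open>e\<close>, and
  \<open>(X * Y) ^ 2 = e *\<^sub>R X ^ 2\<close>. Comparing the signs of these squares determines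
  \<open>e\<close>.\<close>

lemma not_K_commutation:
  assumes \<nu>: "square_sign_map D \<nu>" and s: "s \<in> T - K" and k: "k \<in> K"
    and Y: "Y \<in> D k" "Y * Y = 1" and X: "X \<in> D s"
  shows "X * Y = (\<nu> (s + k) * \<nu> s) *\<^sub>R (Y * X)"
proof (cases "X = 0")
  case False
  have "Y \<noteq> 0" using Y(2) by auto
  then obtain c where c: "c \<noteq> 0" "X * Y = \<iota> c * (Y * X)" using commutator X Y(1) False by blast
  have sk: "s + k \<in> T - K" using K_add[of s k] s k K_subset_T T_add by blast
  have "\<iota> 1 * X = X * Y * Y" by (simp add: \<iota>_1 mult.assoc Y)
  also have "\<dots> = \<iota> c * (Y * (X * Y))" by (simp add: c(2) mult_assoc_swap[OF c(2)] mult.assoc)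
  also have "\<dots> = \<iota> (c * c) * (Y * Y * X)"
    by (simp add: c(2) mult_assoc_swap[OF K_commute[OF k Y(1)]] \<iota>_mult mult.assoc)
  finally have "\<iota> 1 * X = \<iota> (c * c) * X" by (simp add: Y)
  then have "c * c = 1" using right_cancel[OF X False] \<iota>_inject by metis
  then have "c = 1 \<or> c = -1" by (simp add: square_eq_1_iff)
  then obtain e :: real where e: "e = 1 \<or> e = -1" "c = of_real e"
    by (metis of_real_1 of_real_minus)
  then have XY: "X * Y = e *\<^sub>R (Y * X)" using c(2) by (simp add: \<iota>_of_real)
  have "(X * Y) * (X * Y) = X * (Y * X) * Y" by (simp add: mult.assoc)
  also have "\<dots> = e *\<^sub>R (X * (X * Y) * Y)" using e(1) XY by auto
  finally have sq: "(X * Y) ^ 2 = e *\<^sub>R X ^ 2" by (simp add: mult.assoc Y power2_eq_square)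
  have XY': "X * Y \<in> D (s + k)" "X * Y \<noteq> 0"
    using mult_closed[OF X Y(1)] mult_nonzero[OF X False \<open>Y \<noteq> 0\<close>] .
  obtain a where a: "a > 0" "X ^ 2 = a *\<^sub>R (\<nu> s *\<^sub>R 1)"
    using \<nu> s X False unfolding square_sign_map_def by blast
  obtain b where b: "b > 0" "(X * Y) ^ 2 = b *\<^sub>R (\<nu> (s + k) *\<^sub>R 1)"
    using \<nu> sk XY' unfolding square_sign_map_def by blast
  have "(b * \<nu> (s + k)) *\<^sub>R (1::'a) = (e * a * \<nu> s) *\<^sub>R 1" using sq a b by simp
  then have "b * \<nu> (s + k) = e * a * \<nu> s"
    by (simp only: real_vector.scale_right_imp_eq[OF one_neq_zero])
  then have "e = \<nu> (s + k) * \<nu> s"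
    using a(1) b(1) e(1) sign_values[OF \<nu> s] sign_values[OF \<nu> sk] by auto
  then show ?thesis using XY by simp
qed simp

text \<open>Pick \<open>X\<close> of degree \<open>t\<close> and apply the preceding rule to
  \<open>X\<close> and to \<open>X * Z\<close>, both of degree outside \<open>K\<close>; the product
  of the two signs is the commutation sign of \<open>Z\<close> and \<open>Y\<close>.\<close>

lemma K_commutation:
  assumes \<nu>: "square_sign_map D \<nu>" and t: "t \<in> T - K" and s: "s \<in> K" and k: "k \<in> K"
    and Y: "Y \<in> D k" "Y * Y = 1" and Z: "Z \<in> D s"
  shows "Z * Y = (\<nu> (t + s + k) * \<nu> (t + s) * \<nu> (t + k) * \<nu> t) *\<^sub>R (Y * Z)"
proof -
  obtain X where X: "X \<in> D t" "X \<noteq> 0" using t support_iff by blast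
  have ts: "t + s \<in> T - K" and tk: "t + k \<in> T - K"
    using K_add t s k K_subset_T T_add by blast+
  have XY: "X * Y = (\<nu> (t + k) * \<nu> t) *\<^sub>R (Y * X)"
    using not_K_commutation[OF \<nu> t k Y X(1)] .
  then have YX: "Y * X = (\<nu> (t + k) * \<nu> t) *\<^sub>R (X * Y)"
    using sign_values[OF \<nu> t] sign_values[OF \<nu> tk] by auto
  have "X * (Z * Y) = (\<nu> (t + s + k) * \<nu> (t + s)) *\<^sub>R (Y * X * Z)"
    using not_K_commutation[OF \<nu> ts k Y mult_closed[OF X(1) Z]] by (simp add: mult.assoc)
  also have "\<dots> = X * ((\<nu> (t + s + k) * \<nu> (t + s) * \<nu> (t + k) * \<nu> t) *\<^sub>R (Y * Z))"
    by (simp add: YX mult.assoc)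
  finally show ?thesis using left_cancel[OF X] by blast
qed

end

section \<open>Partial isomorphisms and their extension\<close>

locale same_square_signs =
  A: complex_division_grading D + B: complex_division_grading D'
  for D :: "'g::ab_group_add \<Rightarrow> 'a::real_algebra_1 set" and D' :: "'g \<Rightarrow> 'b::real_algebra_1 set" +
  fixes \<nu>
  assumes same_support: "B.T = A.T" and same_K: "B.K = A.K"
    and sign: "square_sign_map D \<nu>" and sign': "square_sign_map D' \<nu>"
begin

text \<open>Bijectivity onto the components of \<open>D'\<close> is a consequence.\<close>

definition partial_iso :: "'g set \<Rightarrow> ('g \<Rightarrow> 'a \<Rightarrow> 'b) \<Rightarrow> bool" where
  "partial_iso H \<psi> \<longleftrightarrow> 0 \<in> H \<and> H \<subseteq> A.T \<and> (\<forall>s\<in>H. \<forall>t\<in>H. s + t \<in> H) \<and> \<psi> 0 1 = 1 \<and>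
     (\<forall>s\<in>H. \<forall>x\<in>D s. \<psi> s x \<in> D' s \<and> (\<forall>c. \<psi> s (c *\<^sub>R x) = c *\<^sub>R \<psi> s x) \<and>
       (\<forall>y\<in>D s. \<psi> s (x + y) = \<psi> s x + \<psi> s y) \<and>
       (\<forall>t\<in>H. \<forall>y\<in>D t. \<psi> (s + t) (x * y) = \<psi> s x * \<psi> t y))"

lemma partial_isoD:
  assumes "partial_iso H \<psi>"
  shows "0 \<in> H" "H \<subseteq> A.T" "s \<in> H \<Longrightarrow> t \<in> H \<Longrightarrow> s + t \<in> H" "\<psi> 0 1 = 1"
    and "s \<in> H \<Longrightarrow> x \<in> D s \<Longrightarrow> \<psi> s x \<in> D' s"
    and "s \<in> H \<Longrightarrow> x \<in> D s \<Longrightarrow> \<psi> s (c *\<^sub>R x) = c *\<^sub>R \<psi> s x"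
    and "s \<in> H \<Longrightarrow> x \<in> D s \<Longrightarrow> y \<in> D s \<Longrightarrow> \<psi> s (x + y) = \<psi> s x + \<psi> s y"
    and "s \<in> H \<Longrightarrow> t \<in> H \<Longrightarrow> x \<in> D s \<Longrightarrow> y \<in> D t \<Longrightarrow> \<psi> (s + t) (x * y) = \<psi> s x * \<psi> t y"
  using assms unfolding partial_iso_def by blast+

text \<open>As \<open>Y * Y\<close> is a sign, the component of degree \<open>h + k\<close> is that
  of degree \<open>h\<close> times \<open>Y\<close>, and \<psi> extends by sending \<open>Y\<close>
  to \<open>Y'\<close>. Multiplicativity needs \<open>Y'\<close> to move past images as
  \<open>Y\<close> moves past elements with degrees in \<open>H\<close>, which \<open>conj\<close>
  expresses.\<close>

lemma partial_iso_extend: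
  assumes iso: "partial_iso H \<psi>" and k: "k \<in> A.T" "k \<notin> H"
    and Y: "Y \<in> D k" "Y * Y = c *\<^sub>R 1" and Y': "Y' \<in> D' k" "Y' * Y' = c *\<^sub>R 1"
    and c: "c = 1 \<or> c = -1"
    and conj: "\<And>s y. s \<in> H \<Longrightarrow> y \<in> D s \<Longrightarrow> \<psi> s (Y * y * Y) = Y' * \<psi> s y * Y'"
  obtains \<psi>' where "partial_iso (H \<union> {h. h + k \<in> H}) \<psi>'"
proof -
  note p = partial_isoD[OF iso]
  have kk: "k + k = 0" by (rule A.T_double[OF k(1)])
  have addk: "g + k + k = g" for g by (simp add: add.assoc kk)
  have double: "s + s = 0" if "s \<in> H" for s using A.T_double p(2) that by blast
  have outside: "s + h \<notin> H" if "s \<in> H" "h \<notin> H" for s h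
  proof
    assume "s + h \<in> H"
    then have "s + (s + h) \<in> H" using p(3) that by blast
    then show False using that double by (simp add: add.assoc[symmetric])
  qed
  have cc: "c * c = 1" using c by auto
  let ?H = "H \<union> {h. h + k \<in> H}"
  \<comment> \<open>For \<open>g\<close> outside \<open>H\<close>, \<open>x\<close> equals
    \<open>c *\<^sub>R (x * Y * Y)\<close> because \<open>c * c = 1\<close>, which dictates its
    image.\<close>
  define \<psi>' where "\<psi>' g x = (if g \<in> H then \<psi> g x else c *\<^sub>R (\<psi> (g + k) (x * Y) * Y'))" for g x
  have xY: "x * Y \<in> D (g + k)" if "x \<in> D g" for x g by (rule A.mult_closed[OF that Y(1)])
  have YxY: "Y * x * Y \<in> D g" if "x \<in> D g" for x g
    using A.mult_closed[OF A.mult_closed[OF Y(1) that] Y(1)]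
    by (simp add: add.commute[of k] addk)
  have closed: "s + t \<in> ?H" if "s \<in> ?H" "t \<in> ?H" for s t
  proof -
    have "(s + k) + t = s + t + k" "s + (t + k) = s + t + k" "(s + k) + (t + k) = s + t"
      using addk[of "s + t"] by (simp_all add: ac_simps)
    then show ?thesis using that p(3)[of s t] p(3)[of "s + k" t] p(3)[of s "t + k"]
        p(3)[of "s + k" "t + k"] unfolding Un_iff mem_Collect_eq by metis
  qed
  have mult: "\<psi>' (s + t) (x * y) = \<psi>' s x * \<psi>' t y"
    if "s \<in> ?H" "t \<in> ?H" and x: "x \<in> D s" and y: "y \<in> D t" for s t x y
  proof -
    consider "s \<in> H" "t \<in> H" | "s \<in> H" "t \<notin> H" "t + k \<in> H" | "s \<notin> H" "s + k \<in> H" "t \<in> H"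
      | "s \<notin> H" "s + k \<in> H" "t \<notin> H" "t + k \<in> H" using \<open>s \<in> ?H\<close> \<open>t \<in> ?H\<close> by blast
    then show ?thesis
    proof cases
      case 1
      then show ?thesis using p(3,8) x y by (simp add: \<psi>'_def)
    next
      case 2
      then have "\<psi> (s + (t + k)) (x * (y * Y)) = \<psi> s x * \<psi> (t + k) (y * Y)"
        by (intro p(8) x xY y)
      then show ?thesis using 2 outside by (simp add: \<psi>'_def add.assoc mult.assoc)
    next
      case 3
      \<comment> \<open>Inserting \<open>Y * Y\<close> between \<open>x\<close> and \<open>y\<close>
        leaves a product of elements with degrees in \<open>H\<close>, the second one being a
        conjugate of \<open>y\<close> up to sign.\<close>
      have "x * y * Y = c *\<^sub>R ((x * Y) * (Y * y * Y))"
        using cc by (simp add: mult.assoc mult_assoc_swap[of Y Y "c *\<^sub>R 1" 1, simplified, OF Y(2)])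
      moreover have "\<psi> (s + k + t) ((x * Y) * (Y * y * Y)) = \<psi> (s + k) (x * Y) * (Y' * \<psi> t y * Y')"
        using p(8)[OF 3(2,3) xY[OF x] YxY[OF y]] conj[OF 3(3) y] by simp
      moreover have "s + k + t \<in> H" "(x * Y) * (Y * y * Y) \<in> D (s + k + t)"
        using p(3) 3 A.mult_closed xY[OF x] YxY[OF y] by blast+
      ultimately have "\<psi> (s + k + t) (x * y * Y) * Y' = \<psi> (s + k) (x * Y) * (Y' * \<psi> t y)"
        using cc by (simp add: p(6) mult.assoc Y')
      then show ?thesis using 3 outside[of t s] by (simp add: \<psi>'_def add_ac mult.assoc)
    next
      case 4
      \<comment> \<open>\<open>Y * Y\<close> occurs on both sides of \<open>y\<close>, and the two
        signs cancel.\<close>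
      have eq: "(x * Y) * (Y * (y * Y) * Y) = x * y"
        using cc by (simp add: mult.assoc mult_assoc_swap[of Y Y "c *\<^sub>R 1" 1, simplified, OF Y(2)] Y(2))
      have deg: "s + k + (t + k) = s + t" using addk[of "s + t"] by (simp add: ac_simps)
      have "s + t \<in> H" using p(3)[OF 4(2,4)] unfolding deg .
      moreover have "\<psi> (s + t) (x * y) = \<psi> (s + k) (x * Y) * (Y' * \<psi> (t + k) (y * Y) * Y')"
        using p(8)[OF 4(2,4) xY[OF x] YxY[OF xY[OF y]]]
        unfolding eq deg conj[OF 4(4) xY[OF y]] .
      ultimately show ?thesis using 4 cc by (simp add: \<psi>'_def mult.assoc)
    qed
  qed
  have rest: "\<psi>' s x \<in> D' s \<and> (\<forall>c. \<psi>' s (c *\<^sub>R x) = c *\<^sub>R \<psi>' s x) \<and>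
       (\<forall>y\<in>D s. \<psi>' s (x + y) = \<psi>' s x + \<psi>' s y)" if s: "s \<in> ?H" and x: "x \<in> D s" for s x
  proof (cases "s \<in> H")
    case False
    then have sk: "s + k \<in> H" using s by blast
    have "\<psi> (s + k) (x * Y) * Y' \<in> D' (s + k + k)"
      by (intro B.mult_closed p(5) sk xY x Y')
    then show ?thesis using sk xY x False
      by (simp add: \<psi>'_def addk B.scale_closed p(6,7) ring_distribs scaleR_add_right mult.commute)
  qed (use x p in \<open>simp add: \<psi>'_def\<close>)
  have "?H \<subseteq> A.T" using p(2) A.T_add[OF _ k(1), of "_ + k"] unfolding addk by blast
  then have "partial_iso ?H \<psi>'"
    unfolding partial_iso_def using closed mult rest p(1,4) by (auto simp: \<psi>'_def)
  then show ?thesis by (rule that)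
qed

lemma partial_iso_neutral: "partial_iso {0} (\<lambda>_ x. B.\<iota> (inv A.\<iota> x))"
proof -
  have inv: "inv A.\<iota> (A.\<iota> z) = z" for z
    by (rule inv_f_f) (simp add: inj_def A.\<iota>_inject)
  have "inv A.\<iota> 1 = 1" using inv[of 1] by (simp add: A.\<iota>_1)
  then show ?thesis
    unfolding partial_iso_def
    by (auto dest!: A.neutral_component_eq simp: inv B.\<iota>_component B.\<iota>_1 B.\<iota>_add B.\<iota>_scale B.\<iota>_mult
      A.\<iota>_add[symmetric] A.\<iota>_scale[symmetric] A.\<iota>_mult[symmetric])
qed

section \<open>A partial isomorphism on the whole support\<close>

text \<open>Adjoin elements of degree \<open>t\<close> with square \<nu>(t) to both copies of
  \<complex>. On either side \<open>X * y * X\<close> is \<nu>(t) times the complex conjugate of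
  \<open>y\<close>, so the extension applies.\<close>

lemma partial_iso_not_K:
  assumes t: "t \<in> A.T - A.K"
  obtains H \<psi> where "partial_iso H \<psi>" "t \<in> H"
proof -
  obtain X where X: "X \<in> D t" "X * X = \<nu> t *\<^sub>R 1" using A.square_one_exists_not_K[OF sign t] .
  have t': "t \<in> B.T - B.K" using t same_support same_K by simp
  obtain X' where X': "X' \<in> D' t" "X' * X' = \<nu> t *\<^sub>R 1"
    using B.square_one_exists_not_K[OF sign' t'] .
  have inv: "inv A.\<iota> (A.\<iota> z) = z" for z
    by (rule inv_f_f) (simp add: inj_def A.\<iota>_inject)
  have t0: "t \<notin> {0}" using t A.K_iff_commute[of 1 0] by auto
  have "B.\<iota> (inv A.\<iota> (X * y * X)) = X' * B.\<iota> (inv A.\<iota> y) * X'" if "s \<in> {0}" "y \<in> D s" for s y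
  proof -
    obtain z where z: "y = A.\<iota> z" using A.neutral_component_eq \<open>y \<in> D s\<close> \<open>s \<in> {0}\<close> by blast
    have "X * y * X = A.\<iota> (\<nu> t *\<^sub>R cnj z)"
      using A.anti_commute[of t X z] t X by (simp add: z mult.assoc A.\<iota>_scale)
    moreover have "X' * B.\<iota> z * X' = B.\<iota> (\<nu> t *\<^sub>R cnj z)"
      using B.anti_commute[of t X' z] t' X' by (simp add: mult.assoc B.\<iota>_scale)
    ultimately show ?thesis by (simp add: z inv)
  qed
  then obtain \<psi> where "partial_iso ({0} \<union> {h. h + t \<in> {0}}) \<psi>"
    using partial_iso_extend[OF partial_iso_neutral _ t0 X X' A.sign_values[OF sign t]] t by blast
  then show ?thesis using that A.T_double t by blast
qed

text \<open>On both sides the commutation factor is the same expression in \<nu>; for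
  \<open>s\<close> in \<open>K\<close> it involves an auxiliary degree outside \<open>K\<close>,
  chosen once for both.\<close>

lemma K_commutation_same:
  assumes s: "s \<in> A.T" and k: "k \<in> A.K" and Y: "Y \<in> D k" "Y * Y = 1" and Y': "Y' \<in> D' k" "Y' * Y' = 1"
  obtains e where "\<And>y. y \<in> D s \<Longrightarrow> y * Y = e *\<^sub>R (Y * y)" "\<And>y. y \<in> D' s \<Longrightarrow> y * Y' = e *\<^sub>R (Y' * y)"
proof (cases "s \<in> A.K")
  case True
  obtain t where t: "t \<in> A.T - A.K" using A.not_K_exists by blast
  show ?thesis
    using that[OF A.K_commutation[OF sign t True k Y]
      B.K_commutation[OF sign', unfolded same_support same_K, OF t True k Y']] .
next
  case False
  then have s: "s \<in> A.T - A.K" using s by blast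
  show ?thesis
    using that[OF A.not_K_commutation[OF sign s k Y]
      B.not_K_commutation[OF sign', unfolded same_support same_K, OF s k Y']] .
qed

text \<open>Brings commutation up to a factor into the form demanded by
  \<open>partial_iso_extend\<close>.\<close>

lemma conj_by_involution:
  fixes Y :: "'c::real_algebra_1"
  assumes "y * Y = e *\<^sub>R (Y * y)" "Y * Y = 1"
  shows "Y * y * Y = e *\<^sub>R y"
  using assms by (simp add: mult.assoc) (simp add: mult.assoc[symmetric])

text \<open>Starting from a domain with some \<open>t0\<close> outside \<open>K\<close>, adjoin
  elements with degrees in \<open>K\<close> and square 1 until \<open>T\<close> is exhausted; the
  number of missing degrees drops each time.\<close>

lemma full_partial_iso: "\<exists>\<psi>. partial_iso A.T \<psi>"
proof -
  obtain t0 where t0: "t0 \<in> A.T - A.K" using A.not_K_exists by blast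
  have "\<exists>\<psi>. partial_iso A.T \<psi>" if "partial_iso H \<psi>" "t0 \<in> H" for H \<psi>
    using that
  proof (induction "card (A.T - H)" arbitrary: H \<psi> rule: less_induct)
    case less
    note p = partial_isoD[OF less.prems(1)]
    show ?case
    proof (cases "H = A.T")
      case False
      then obtain t where t: "t \<in> A.T" "t \<notin> H" using p(2) by blast
      \<comment> \<open>A missing degree outside \<open>K\<close> is translated into
        \<open>K\<close> by \<open>t0\<close>, and stays missing because \<open>t0\<close> lies in
        \<open>H\<close>.\<close>
      obtain k where k: "k \<in> A.K" "k \<notin> H"
      proof (cases "t \<in> A.K")
        case False
        have "t + t0 \<notin> H"
        proof
          assume "t + t0 \<in> H"
          then have "t + t0 + t0 \<in> H" using p(3) less.prems(2) by blast
          then show False using t(2) A.T_double[of t0] t0 by (simp add: add.assoc)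
        qed
        moreover have "t + t0 \<in> A.K" using A.K_add[of t t0] t(1) t0 False by blast
        ultimately show ?thesis using that by blast
      qed (use t that in blast)
      have kT: "k \<in> A.T" by (rule A.K_subset_T[OF k(1)])
      obtain Y where Y: "Y \<in> D k" "Y * Y = 1" using A.square_one_exists[OF k(1)] .
      obtain Y' where Y': "Y' \<in> D' k" "Y' * Y' = 1"
        using B.square_one_exists[unfolded same_K, OF k(1)] .
      have conj: "\<psi> s (Y * y * Y) = Y' * \<psi> s y * Y'" if s: "s \<in> H" and y: "y \<in> D s" for s y
      proof -
        obtain e where e: "\<And>y. y \<in> D s \<Longrightarrow> y * Y = e *\<^sub>R (Y * y)"
          "\<And>y. y \<in> D' s \<Longrightarrow> y * Y' = e *\<^sub>R (Y' * y)"
          using K_commutation_same[OF _ k(1) Y Y'] p(2) s by blast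
        show ?thesis
          using conj_by_involution[OF e(1)[OF y] Y(2)]
            conj_by_involution[OF e(2)[OF p(5)[OF s y]] Y'(2)] p(6)[OF s y] by simp
      qed
      obtain \<psi>' where \<psi>': "partial_iso (H \<union> {h. h + k \<in> H}) \<psi>'"
        by (rule partial_iso_extend[OF less.prems(1) kT k(2) Y(1) _ Y'(1) _ _ conj, of 1])
          (simp_all add: Y(2) Y'(2))
      have "k + k \<in> H" using A.T_double[OF kT] p(1) by simp
      then have "A.T - (H \<union> {h. h + k \<in> H}) \<subset> A.T - H" using kT k(2) by blast
      then have "card (A.T - (H \<union> {h. h + k \<in> H})) < card (A.T - H)"
        by (rule psubset_card_mono[rotated]) (simp add: A.finite_T)
      then show ?thesis using less.hyps[OF _ \<psi>'] less.prems(2) by blast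
    qed (use less.prems(1) in blast)
  qed
  then show ?thesis using partial_iso_not_K[OF t0] by metis
qed

section \<open>From partial to graded isomorphisms\<close>

text \<open>\<open>x * x\<close> is a nonzero complex scalar, so \<open>x\<close> has an inverse in
  its own degree; multiplicativity and \<open>\<psi> 0 1 = 1\<close> exclude a zero image.\<close>

lemma partial_iso_nonzero:
  assumes iso: "partial_iso A.T \<psi>" and x: "x \<in> D t" "x \<noteq> 0"
  shows "\<psi> t x \<noteq> 0"
proof
  assume 0: "\<psi> t x = 0"
  note p = partial_isoD[OF iso]
  have t: "t \<in> A.T" by (rule A.supportI[OF x])
  have xx: "x * x \<in> D 0" "x * x \<noteq> 0"
    using A.mult_closed[OF x(1) x(1)] A.T_double[OF t] A.mult_nonzero[OF x x(2)] by simp_all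
  then obtain z where z: "x * x = A.\<iota> z" using A.neutral_component_eq by blast
  have "z \<noteq> 0" using z xx by auto
  then have "1 = A.\<iota> (inverse z) * x * x"
    by (simp add: z mult.assoc A.\<iota>_mult[symmetric] A.\<iota>_1)
  moreover have "\<psi> (t + t) (A.\<iota> (inverse z) * x * x) = \<psi> t (A.\<iota> (inverse z) * x) * \<psi> t x"
    by (intro p(8) t x A.neutral_mult A.\<iota>_component)
  ultimately show False using 0 p(4) A.T_double[OF t] by simp
qed

text \<open>The image \<open>J\<close> of \<open>imag_unit\<close> squares to \<open>-1\<close>, so
  it is not real; hence \<open>\<psi> t x\<close> and \<open>J * \<psi> t x\<close> form a real
  basis of \<open>D' t\<close>.\<close>

lemma partial_iso_onto:
  assumes iso: "partial_iso A.T \<psi>" and t: "t \<in> A.T" and y: "y \<in> D' t"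
  obtains x where "x \<in> D t" "\<psi> t x = y"
proof -
  note p = partial_isoD[OF iso]
  obtain x where x: "x \<in> D t" "x \<noteq> 0" using t A.support_iff by blast
  define J where "J = \<psi> 0 A.imag_unit"
  have Jx: "A.imag_unit * x \<in> D t" by (intro A.neutral_mult A.imag_unit x)
  have J: "J \<in> D' 0" unfolding J_def by (intro p(5) A.imag_unit) simp
  have "\<psi> (0 + 0) (A.imag_unit * A.imag_unit) = J * J"
    unfolding J_def by (intro p(8) A.imag_unit) simp_all
  then have "\<psi> 0 (-1) = J * J" by (simp add: A.imag_unit)
  moreover have "\<psi> 0 (-1) = -1" using p(4) p(6)[of 0 1 "-1"] by simp
  ultimately have "J * J = -1" by simp
  note Jn = square_root_of_minus_one_not_real[OF this]
  have "\<psi> (0 + t) (A.imag_unit * x) = J * \<psi> t x"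
    unfolding J_def by (intro p(8) A.imag_unit t x) simp
  then have \<psi>J: "\<psi> t (A.imag_unit * x) = J * \<psi> t x" by simp
  have x': "\<psi> t x \<in> D' t" "\<psi> t x \<noteq> 0" using p(5) t x partial_iso_nonzero[OF iso] by auto
  have "D' t \<subseteq> span {\<psi> t x, J * \<psi> t x}"
    using B.independent_mult_pair[OF Jn x'] t x' J
    by (intro span_of_independent_pair B.dim_component B.neutral_mult) (simp_all add: same_support)
  then obtain a b where "y = a *\<^sub>R \<psi> t x + b *\<^sub>R (J * \<psi> t x)"
    using y by (auto simp: real_vector.span_insert real_vector.span_singleton algebra_simps)
  then have "\<psi> t (a *\<^sub>R x + b *\<^sub>R (A.imag_unit * x)) = y"
    using p(6,7)[OF t] x Jx A.scale_closed by (simp add: \<psi>J)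
  then show ?thesis using that A.add_closed A.scale_closed x Jx by blast
qed

text \<open>Apply \<psi> to each homogeneous component and add up. Injectivity comes from uniqueness
  of decompositions in the target, surjectivity from their existence.\<close>

lemma graded_isomorphic: "graded_isomorphic D D'"
proof -
  obtain \<psi> where iso: "partial_iso A.T \<psi>" using full_partial_iso by blast
  note p = partial_isoD[OF iso]
  have "\<forall>x. \<exists>f. (\<forall>g. f g \<in> D g) \<and> x = sum f A.T" using A.decompose by blast
  then obtain comp where comp: "\<And>x g. comp x g \<in> D g" "\<And>x. x = sum (comp x) A.T" by metis
  define \<Psi> where "\<Psi> x = (\<Sum>g\<in>A.T. \<psi> g (comp x g))" for x
  have \<Psi>_sum: "\<Psi> (sum f A.T) = (\<Sum>g\<in>A.T. \<psi> g (f g))" if "\<And>g. g \<in> A.T \<Longrightarrow> f g \<in> D g" for f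
  proof -
    have "comp (sum f A.T) g = f g" if "g \<in> A.T" for g
      by (rule A.decompose_unique[OF comp(1) \<open>\<And>g. g \<in> A.T \<Longrightarrow> f g \<in> D g\<close> comp(2)[symmetric] that])
    then show ?thesis by (simp add: \<Psi>_def)
  qed
  have add: "\<Psi> (x + y) = \<Psi> x + \<Psi> y" for x y
  proof -
    have "\<Psi> (sum (\<lambda>g. comp x g + comp y g) A.T) = \<Psi> x + \<Psi> y"
      by (subst \<Psi>_sum) (simp_all add: A.add_closed comp(1) p(7) sum.distrib \<Psi>_def)
    then show ?thesis by (simp add: sum.distrib comp(2)[symmetric])
  qed
  have "\<Psi> (c *\<^sub>R x) = c *\<^sub>R \<Psi> x" for c x
  proof -
    have "\<Psi> (sum (\<lambda>g. c *\<^sub>R comp x g) A.T) = c *\<^sub>R \<Psi> x"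
      by (subst \<Psi>_sum) (simp_all add: A.scale_closed comp(1) p(6) scaleR_sum_right \<Psi>_def)
    then show ?thesis by (simp add: scaleR_sum_right[symmetric] comp(2)[symmetric])
  qed
  then have lin: "linear \<Psi>" using add by (intro linearI)
  have hom: "\<Psi> x = \<psi> g x" if g: "g \<in> A.T" and x: "x \<in> D g" for g x
  proof -
    have "\<psi> h (if h = g then x else 0) = (if h = g then \<psi> g x else 0)" if "h \<in> A.T" for h
      using p(6)[OF that A.zero_component, of 0] by simp
    then show ?thesis
      using \<Psi>_sum[of "\<lambda>h. if h = g then x else 0"] x g A.finite_T by simp
  qed
  have mult: "\<Psi> (x * y) = \<Psi> x * \<Psi> y" for x y
  proof -
    have "x * y = (\<Sum>g\<in>A.T. \<Sum>h\<in>A.T. comp x g * comp y h)"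
      by (subst comp(2)[of x], subst comp(2)[of y]) (rule sum_product)
    then have "\<Psi> (x * y) = (\<Sum>g\<in>A.T. \<Sum>h\<in>A.T. \<Psi> (comp x g * comp y h))"
      by (simp add: linear_sum[OF lin])
    also have "\<dots> = (\<Sum>g\<in>A.T. \<Sum>h\<in>A.T. \<psi> g (comp x g) * \<psi> h (comp y h))"
      by (intro sum.cong refl) (simp add: hom[OF A.T_add A.mult_closed[OF comp(1) comp(1)]] p(8) comp(1))
    finally show ?thesis by (simp add: \<Psi>_def sum_product)
  qed
  have image: "\<Psi> ` D g = D' g" for g
  proof (cases "g \<in> A.T")
    case True
    show ?thesis
    proof (intro subset_antisym subsetI)
      fix y assume "y \<in> D' g"
      then obtain x where "x \<in> D g" "\<psi> g x = y" using partial_iso_onto[OF iso True] by blast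
      then show "y \<in> \<Psi> ` D g" using hom[OF True] by force
    qed (use hom[OF True] p(5)[OF True] in auto)
  next
    case False
    then have "D g = {0}" "D' g = {0}"
      using same_support[symmetric] by (auto simp: grading_support_def)
    then show ?thesis using linear_0[OF lin] by simp
  qed
  have "inj \<Psi>"
    unfolding linear_inj_iff_eq_0[OF lin]
  proof (intro allI impI)
    fix x assume "\<Psi> x = 0"
    then have s: "(\<Sum>g\<in>B.T. \<psi> g (comp x g)) = (\<Sum>g\<in>B.T. 0)" by (simp add: \<Psi>_def same_support)
    have "\<psi> g (comp x g) = 0" if "g \<in> A.T" for g
      using B.decompose_unique[OF _ _ s, of g] p(5) comp(1) that by (simp add: same_support)
    then have "comp x g = 0" if "g \<in> A.T" for g
      using partial_iso_nonzero[OF iso comp(1)] that by blast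
    then show "x = 0" using comp(2)[of x] by simp
  qed
  moreover have "surj \<Psi>"
    unfolding surj_def
  proof
    fix y
    obtain f where f: "\<And>g. f g \<in> D' g" "y = sum f B.T" using B.decompose by blast
    then have "\<forall>g. \<exists>x. f g = \<Psi> x" using image by blast
    then obtain h where "\<And>g. f g = \<Psi> (h g)" by metis
    then show "\<exists>x. y = \<Psi> x" using f(2) by (auto simp: linear_sum[OF lin, symmetric])
  qed
  ultimately show ?thesis
    unfolding graded_isomorphic_def bij_def using lin mult image by blast
qed

end

theorem theorem2p8:
  fixes D :: "'g::ab_group_add \<Rightarrow> 'a::real_algebra_1 set"
  assumes "two_dim_division_graded_csa D"
  shows "(\<exists>!\<nu>. square_sign_map D \<nu>) \<and>
    (\<forall>(D' :: 'g \<Rightarrow> 'b::real_algebra_1 set) \<nu>.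
       two_dim_division_graded_csa D' \<longrightarrow>
       grading_support D' = grading_support D \<longrightarrow>
       neutral_centralizer_support D' = neutral_centralizer_support D \<longrightarrow>
       square_sign_map D \<nu> \<longrightarrow> square_sign_map D' \<nu> \<longrightarrow>
       graded_isomorphic D D')"
proof (intro conjI allI impI)
  show "\<exists>!\<nu>. square_sign_map D \<nu>"
    by (rule complex_division_grading.ex1_square_sign_map) (unfold_locales, fact assms)
next
  fix D' :: "'g \<Rightarrow> 'b set" and \<nu>
  assume "two_dim_division_graded_csa D'"
    "grading_support D' = grading_support D"
    "neutral_centralizer_support D' = neutral_centralizer_support D"
    "square_sign_map D \<nu>" "square_sign_map D' \<nu>"
  then interpret same_square_signs D D' \<nu>
    using assms by unfold_locales
  show "graded_isomorphic D D'" by (rule graded_isomorphic)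
qed

end
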